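(* Let $0<q<1$, $y_0\in\mathbb{R}$, $a>0$, $b>0$, and let $R=\{(t,u,v)\in\mathbb{R}^3 : |t|\le a,\ |u-y_0|\le b,\ |v-y_0|\le b\}$. Let $f:R\to\mathbb{R}$ be continuous with $|f|\le M$ on $R$, where $M>0$. Suppose there are constants $L_1,L_2\geq 0$ such that for all $(t,u_1,v_1),(t,u_2,v_2)\in R$, $$|f(t,u_1,v_1)-f(t,u_2,v_2)|\le L_1|u_1-u_2|+L_2|v_1-v_2|.$$ Let $\zeta=\min\{a,b/M\}$ and $I=[-\zeta,\zeta]$. Then the successive approximations defined on $I$ by $$\phi_0(t)=y_0,\qquad \phi_{k+1}(t)=y_0+\int_0^t f(x,\phi_k(x),\phi_k(qx))\,dx,\quad k=0,1,2,\dots,$$ converge on $I$ to a solution $\phi$ on $I$ of the initial value problem $$y'(t)=f(t,y(t),y(qt)),\qquad y(0)=y_0.$$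
   Context: A solution of the initial value problem on $I$ is a differentiable function $\phi:I\to\mathbb{R}$ (one-sided derivatives at the endpoints) with $(t,\phi(t),\phi(qt))\in R$ and $\phi'(t)=f(t,\phi(t),\phi(qt))$ for all $t\in I$, and $\phi(0)=y_0$. *)

theory Defs
  imports "HOL-Analysis.Analysis"
begin

definition box_R :: "real \<Rightarrow> real \<Rightarrow> real \<Rightarrow> (real \<times> real \<times> real) set" where
  "box_R a b y0 = {(t, u, v). \<bar>t\<bar> \<le> a \<and> \<bar>u - y0\<bar> \<le> b \<and> \<bar>v - y0\<bar> \<le> b}"

text \<open>The derivative is taken within \<open>I\<close>, so it is one-sided at the endpoints of an interval.\<close>

definition ivp_solution ::
  "(real \<times> real \<times> real \<Rightarrow> real) \<Rightarrow> (real \<times> real \<times> real) set \<Rightarrow> real \<Rightarrow> real \<Rightarrow>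
    real set \<Rightarrow> (real \<Rightarrow> real) \<Rightarrow> bool" where
  "ivp_solution f R q y0 I \<phi> \<longleftrightarrow>
     (\<forall>t\<in>I. (t, \<phi> t, \<phi> (q * t)) \<in> R \<and>
        (\<phi> has_real_derivative f (t, \<phi> t, \<phi> (q * t))) (at t within I)) \<and>
     \<phi> 0 = y0"

text \<open>
  The interval integral is oriented: for negative \<open>t\<close> it is minus the integral from \<open>t\<close> to \<open>0\<close>.
  The functions are total, but when \<open>0 < q < 1\<close> and \<open>I\<close> is an interval containing \<open>0\<close>, the
  values on \<open>I\<close> depend only on values of the previous iterate on \<open>I\<close>.
\<close>

primrec succ_approx ::
  "(real \<times> real \<times> real \<Rightarrow> real) \<Rightarrow> real \<Rightarrow> real \<Rightarrow> nat \<Rightarrow> real \<Rightarrow> real" where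
  "succ_approx f q y0 0 = (\<lambda>t. y0)"
| "succ_approx f q y0 (Suc k) =
     (\<lambda>t. y0 + (LBINT x=ereal 0..ereal t. f (x, succ_approx f q y0 k x, succ_approx f q y0 k (q * x))))"

text \<open>
  Well-definedness of the iterates on \<open>I\<close>: \<open>f\<close> is evaluated only at points of its domain \<open>R\<close>,
  and every integral occurring in the recursion exists. Totality of functions and of the integral
  would otherwise hide a failure of either.
\<close>

definition succ_approx_well_defined ::
  "(real \<times> real \<times> real \<Rightarrow> real) \<Rightarrow> (real \<times> real \<times> real) set \<Rightarrow> real \<Rightarrow> real \<Rightarrow> real set \<Rightarrow> bool" where
  "succ_approx_well_defined f R q y0 I \<longleftrightarrow>
     (\<forall>k. \<forall>t\<in>I. (t, succ_approx f q y0 k t, succ_approx f q y0 k (q * t)) \<in> R \<and>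
        interval_lebesgue_integrable lborel (ereal 0) (ereal t)
          (\<lambda>x. f (x, succ_approx f q y0 k x, succ_approx f q y0 k (q * x))))"

end

theory Submission
  imports Defs
begin

text \<open>
  Picard iteration. Since \<open>0 < q < 1\<close>, the map \<open>x \<mapsto> q * x\<close> sends the symmetric interval
  \<open>[-z, z]\<close> into itself and satisfies \<open>\<bar>q * x\<bar> \<le> \<bar>x\<bar>\<close>; hence a bound \<open>c * \<bar>x\<bar> ^ n\<close> on the
  difference of two functions controls the proportional delay term as well as the undelayed one,
  and the delay equation behaves like an ordinary one with Lipschitz constant \<open>L1 + L2\<close>.
  Consecutive iterates then differ by at most \<open>M * (L1 + L2) ^ k * \<bar>t\<bar> ^ (k + 1) / (k + 1)!\<close>, so
  they converge uniformly, and their limit is a fixed point of the integral operator.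
\<close>

section \<open>Oriented integrals from 0 over a symmetric interval\<close>

lemma abs_interval_integral_le_power:
  fixes g :: "real \<Rightarrow> real"
  assumes cont: "continuous_on {-z..z} g"
    and bound: "\<And>x. x \<in> {-z..z} \<Longrightarrow> \<bar>g x\<bar> \<le> c * \<bar>x\<bar> ^ n"
    and t: "t \<in> {-z..z}"
  shows "\<bar>LBINT x=ereal 0..ereal t. g x\<bar> \<le> c * \<bar>t\<bar> ^ Suc n / Suc n"
proof -
  \<comment> \<open>Stated for an arbitrary integrand so that it serves both \<open>g\<close> and
    its reflection: the bound depends on \<open>x\<close> only through its absolute value, so
    negative \<open>t\<close> reduces to positive \<open>-t\<close>.\<close>
  have pos: "\<bar>LBINT x=ereal 0..ereal s. h x\<bar> \<le> c * s ^ Suc n / Suc n"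
    if s: "0 \<le> s" and h: "continuous_on {0..s} h"
      and le: "\<And>x. x \<in> {0..s} \<Longrightarrow> \<bar>h x\<bar> \<le> c * x ^ n" for s and h :: "real \<Rightarrow> real"
  proof -
    have eq: "(LBINT x=ereal 0..ereal s. h x) = integral {0..s} h"
      using s h by (intro interval_integral_eq_integral borel_integrable_atLeastAtMost') auto
    have "((\<lambda>x. c * x ^ Suc n / Suc n) has_vector_derivative c * x ^ n) (at x within {0..s})" for x
      unfolding has_real_derivative_iff_has_vector_derivative[symmetric]
      by (rule derivative_eq_intros refl | simp)+
    then have "((\<lambda>x. c * x ^ n) has_integral c * s ^ Suc n / Suc n - c * 0 ^ Suc n / Suc n) {0..s}"
      using s by (intro fundamental_theorem_of_calculus) auto
    then have int: "((\<lambda>x. c * x ^ n) has_integral c * s ^ Suc n / Suc n) {0..s}"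
      by simp
    have "norm (integral {0..s} h) \<le> integral {0..s} (\<lambda>x. c * x ^ n)"
      using int le h
      by (intro integral_norm_bound_integral integrable_continuous_real continuous_intros) auto
    then show ?thesis
      using eq integral_unique[OF int] by simp
  qed
  show ?thesis
  proof (cases "0 \<le> t")
    case True
    have "\<bar>LBINT x=ereal 0..ereal t. g x\<bar> \<le> c * t ^ Suc n / Suc n"
    proof (rule pos[OF True])
      show "continuous_on {0..t} g"
        using t by (intro continuous_on_subset[OF cont]) auto
    next
      fix x assume "x \<in> {0..t}"
      then show "\<bar>g x\<bar> \<le> c * x ^ n"
        using bound[of x] t by auto
    qed
    then show ?thesis using True by simp
  next
    case False
    \<comment> \<open>Reflection gives the integral from \<open>-t\<close> to \<open>-0\<close>;
      reversing its endpoints produces the factor \<open>-1\<close>, which the absolute value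
      absorbs.\<close>
    have "(LBINT x=ereal 0..ereal t. g x) = (LBINT x=ereal (-0)..ereal (-t). g (-x)) * (-1)"
      using interval_integral_reflect[of "ereal 0" "ereal t" g]
        interval_integral_endpoints_reverse[of "ereal (-t)" "ereal (-0)" "\<lambda>x. g (-x)"]
      by simp
    moreover have "\<bar>LBINT x=ereal 0..ereal (-t). g (-x)\<bar> \<le> c * (-t) ^ Suc n / Suc n"
    proof (rule pos)
      show "0 \<le> - t" using False by simp
      show "continuous_on {0..-t} (\<lambda>x. g (-x))"
        using t by (intro continuous_on_compose2[OF cont] continuous_intros) auto
    next
      fix x assume "x \<in> {0..-t}"
      then show "\<bar>g (-x)\<bar> \<le> c * x ^ n"
        using bound[of "-x"] t by auto
    qed
    ultimately show ?thesis using False by simp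
  qed
qed

lemma interval_integrable_symmetric:
  fixes g :: "real \<Rightarrow> real"
  assumes "continuous_on {-z..z} g" "t \<in> {-z..z}"
  shows "interval_lebesgue_integrable lborel (ereal 0) (ereal t) g"
proof (cases "0 \<le> t")
  case True
  then show ?thesis
    using assms by (intro interval_integrable_continuous_on) (auto intro: continuous_on_subset)
next
  case False
  then have "interval_lebesgue_integrable lborel (ereal t) (ereal 0) g"
    using assms by (intro interval_integrable_continuous_on) (auto intro: continuous_on_subset)
  then show ?thesis
    by (simp add: interval_integrable_endpoints_reverse[of "ereal 0"])
qed

section \<open>The integral operator of the delay equation\<close>

locale proportional_delay_ivp =
  fixes q y0 a b M L1 L2 z :: real
    and f :: "real \<times> real \<times> real \<Rightarrow> real"
  assumes q: "0 < q" "q < 1"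
    and z: "0 \<le> z" "z \<le> a" "M * z \<le> b"
    and b: "0 \<le> b"
    and M: "0 \<le> M"
    and f_cont: "continuous_on (box_R a b y0) f"
    and f_bound: "\<And>p. p \<in> box_R a b y0 \<Longrightarrow> \<bar>f p\<bar> \<le> M"
    and L: "0 \<le> L1" "0 \<le> L2"
    and f_lipschitz: "\<And>t u1 v1 u2 v2.
      (t, u1, v1) \<in> box_R a b y0 \<Longrightarrow> (t, u2, v2) \<in> box_R a b y0 \<Longrightarrow>
      \<bar>f (t, u1, v1) - f (t, u2, v2)\<bar> \<le> L1 * \<bar>u1 - u2\<bar> + L2 * \<bar>v1 - v2\<bar>"
begin

text \<open>The class in which the iteration takes place: it keeps the arguments of \<open>f\<close>
  in the box and the integrand continuous, and it is preserved by \<open>picard\<close> and by the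
  uniform limit of the iterates.\<close>

definition admissible :: "(real \<Rightarrow> real) \<Rightarrow> bool" where
  "admissible u \<longleftrightarrow> continuous_on {-z..z} u \<and> (\<forall>x\<in>{-z..z}. \<bar>u x - y0\<bar> \<le> b)"

definition rhs :: "(real \<Rightarrow> real) \<Rightarrow> real \<Rightarrow> real" where
  "rhs u x = f (x, u x, u (q * x))"

definition picard :: "(real \<Rightarrow> real) \<Rightarrow> real \<Rightarrow> real" where
  "picard u t = y0 + (LBINT x=ereal 0..ereal t. rhs u x)"

abbreviation iter :: "nat \<Rightarrow> real \<Rightarrow> real" where
  "iter \<equiv> succ_approx f q y0"

lemma iter_Suc: "iter (Suc k) = picard (iter k)"
  by (simp add: picard_def rhs_def fun_eq_iff)

lemma abs_scale_le: "\<bar>q * x\<bar> \<le> \<bar>x\<bar>"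
  using q by (simp add: abs_mult mult_left_le_one_le)

lemma scale_mem: "x \<in> {-z..z} \<Longrightarrow> q * x \<in> {-z..z}"
  using abs_scale_le[of x] by auto

lemma admissible_mem_box:
  "admissible u \<Longrightarrow> x \<in> {-z..z} \<Longrightarrow> (x, u x, u (q * x)) \<in> box_R a b y0"
  using scale_mem[of x] z by (auto simp: admissible_def box_R_def)

lemma continuous_on_rhs:
  assumes "admissible u"
  shows "continuous_on {-z..z} (rhs u)"
proof -
  have u: "continuous_on {-z..z} u"
    using assms by (simp add: admissible_def)
  have uq: "continuous_on {-z..z} (\<lambda>x. u (q * x))"
    using scale_mem by (intro continuous_on_compose2[OF u] continuous_intros) blast
  show ?thesis
    unfolding rhs_def
    using admissible_mem_box[OF assms]
    by (intro continuous_on_compose2[OF f_cont] continuous_on_Pair continuous_on_id u uq) blast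
qed

lemma rhs_diff_le:
  assumes u: "admissible u" and v: "admissible v"
    and le: "\<And>x. x \<in> {-z..z} \<Longrightarrow> \<bar>u x - v x\<bar> \<le> c * \<bar>x\<bar> ^ n"
    and x: "x \<in> {-z..z}" and c: "0 \<le> c"
  shows "\<bar>rhs u x - rhs v x\<bar> \<le> (L1 + L2) * c * \<bar>x\<bar> ^ n"
proof -
  have "\<bar>rhs u x - rhs v x\<bar> \<le> L1 * \<bar>u x - v x\<bar> + L2 * \<bar>u (q * x) - v (q * x)\<bar>"
    unfolding rhs_def using u v x by (intro f_lipschitz admissible_mem_box)
  also have "\<dots> \<le> L1 * (c * \<bar>x\<bar> ^ n) + L2 * (c * \<bar>x\<bar> ^ n)"
  proof (intro add_mono mult_left_mono L le x)
    have "\<bar>u (q * x) - v (q * x)\<bar> \<le> c * \<bar>q * x\<bar> ^ n"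
      by (intro le scale_mem x)
    also have "\<dots> \<le> c * \<bar>x\<bar> ^ n"
      by (intro mult_left_mono power_mono abs_scale_le c) simp
    finally show "\<bar>u (q * x) - v (q * x)\<bar> \<le> c * \<bar>x\<bar> ^ n" .
  qed
  finally show ?thesis by (simp add: algebra_simps)
qed

text \<open>Each application of \<open>picard\<close> raises the exponent by one and divides by the
  new exponent. Iterated, this builds up the factorial; with \<open>n = 0\<close> it gives
  continuity of \<open>picard\<close> under uniform convergence.\<close>

lemma picard_diff_le:
  assumes "admissible u" "admissible v"
    and "\<And>x. x \<in> {-z..z} \<Longrightarrow> \<bar>u x - v x\<bar> \<le> c * \<bar>x\<bar> ^ n"
    and t: "t \<in> {-z..z}" and "0 \<le> c"
  shows "\<bar>picard u t - picard v t\<bar> \<le> (L1 + L2) * c * \<bar>t\<bar> ^ Suc n / Suc n"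
proof -
  have "picard u t - picard v t = (LBINT x=ereal 0..ereal t. rhs u x - rhs v x)"
    unfolding picard_def
    by (subst interval_lebesgue_integral_diff(2))
      (use assms in \<open>auto intro!: interval_integrable_symmetric continuous_on_rhs\<close>)
  moreover have "\<bar>LBINT x=ereal 0..ereal t. rhs u x - rhs v x\<bar>
      \<le> (L1 + L2) * c * \<bar>t\<bar> ^ Suc n / Suc n"
    using assms
    by (intro abs_interval_integral_le_power[OF _ _ t] continuous_intros continuous_on_rhs
        rhs_diff_le)
  ultimately show ?thesis by simp
qed

text \<open>The integral estimate with exponent 0 and constant \<open>M\<close>. It keeps the image
  of \<open>picard\<close> in the box and starts the induction on consecutive iterates.\<close>

lemma picard_bound:
  assumes "admissible u" and t: "t \<in> {-z..z}"
  shows "\<bar>picard u t - y0\<bar> \<le> M * \<bar>t\<bar>"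
  using abs_interval_integral_le_power[OF continuous_on_rhs[OF assms(1)] _ t, of M 0]
    f_bound admissible_mem_box[OF assms(1)]
  by (simp add: picard_def rhs_def)

lemma picard_has_real_derivative:
  assumes "admissible u" "t \<in> {-z..z}"
  shows "(picard u has_real_derivative rhs u t) (at t within {-z..z})"
proof -
  have "((\<lambda>s. LBINT x=ereal 0..ereal s. rhs u x) has_real_derivative rhs u t) (at t within {-z..z})"
    unfolding has_real_derivative_iff_has_vector_derivative
    using assms z by (intro interval_integral_FTC2 continuous_on_rhs) auto
  then have "((\<lambda>s. y0 + (LBINT x=ereal 0..ereal s. rhs u x)) has_real_derivative 0 + rhs u t)
      (at t within {-z..z})"
    by (intro DERIV_add DERIV_const)
  then show ?thesis
    by (simp add: picard_def[abs_def])
qed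

text \<open>Here \<open>M * z \<le> b\<close> enters: the graph cannot leave the box within time
  \<open>z\<close> when its slope is at most \<open>M\<close>.\<close>

lemma admissible_picard:
  assumes "admissible u"
  shows "admissible (picard u)"
  unfolding admissible_def
proof (intro conjI ballI)
  show "continuous_on {-z..z} (picard u)"
    using picard_has_real_derivative[OF assms] by (rule DERIV_continuous_on)
next
  fix x assume x: "x \<in> {-z..z}"
  have "M * \<bar>x\<bar> \<le> M * z"
    using x M by (intro mult_left_mono) auto
  then show "\<bar>picard u x - y0\<bar> \<le> b"
    using picard_bound[OF assms x] z by linarith
qed

section \<open>Uniform convergence of the iterates\<close>

lemma admissible_iter: "admissible (iter k)"
proof (induction k)
  case 0
  show ?case using b by (simp add: admissible_def)
next
  case (Suc k)
  then show ?case unfolding iter_Suc by (rule admissible_picard)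
qed

lemma succ_approx_well_defined: "succ_approx_well_defined f (box_R a b y0) q y0 {-z..z}"
  using admissible_mem_box[OF admissible_iter]
    interval_integrable_symmetric[OF continuous_on_rhs[OF admissible_iter]]
  by (simp add: succ_approx_well_defined_def rhs_def[abs_def])

lemma iter_diff_le:
  assumes "t \<in> {-z..z}"
  shows "\<bar>iter (Suc k) t - iter k t\<bar> \<le> M * (L1 + L2) ^ k / fact (Suc k) * \<bar>t\<bar> ^ Suc k"
  using assms
proof (induction k arbitrary: t)
  case 0
  then show ?case
    \<comment> \<open>\<open>iter 0\<close> is constantly \<open>y0\<close>, so the first difference
      is exactly what \<open>picard_bound\<close> estimates.\<close>
    using picard_bound[OF admissible_iter[of 0]] unfolding iter_Suc by simp
next
  case (Suc k)
  have "\<bar>picard (iter (Suc k)) t - picard (iter k) t\<bar>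
      \<le> (L1 + L2) * (M * (L1 + L2) ^ k / fact (Suc k)) * \<bar>t\<bar> ^ Suc (Suc k) / Suc (Suc k)"
    using Suc.IH Suc.prems M L by (intro picard_diff_le admissible_iter) auto
  also have "\<dots> = M * (L1 + L2) ^ Suc k / fact (Suc (Suc k)) * \<bar>t\<bar> ^ Suc (Suc k)"
    by (simp add: field_simps)
  finally show ?case unfolding iter_Suc .
qed

text \<open>The iterates are the partial sums of a telescoping series, to which the Weierstrass
  M-test applies.\<close>

lemma uniform_limit_iter:
  obtains \<phi> where "uniform_limit {-z..z} iter \<phi> sequentially"
proof -
  define D where "D k t = iter (Suc k) t - iter k t" for k t
  \<comment> \<open>The majorant is a multiple of the exponential series at
    \<open>(L1 + L2) * z\<close>. To reach this form, \<open>fact (Suc k)\<close> is weakened to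
    \<open>fact k\<close> and one factor \<open>z\<close> is split off
    \<open>z ^ Suc k\<close>.\<close>
  define B where "B k = M * z * (inverse (fact k) * ((L1 + L2) * z) ^ k)" for k
  have "norm (D k t) \<le> B k" if t: "t \<in> {-z..z}" for k t
  proof -
    have "norm (D k t) \<le> M * (L1 + L2) ^ k / fact (Suc k) * \<bar>t\<bar> ^ Suc k"
      using iter_diff_le[OF t] by (simp add: D_def)
    also have "\<dots> \<le> M * (L1 + L2) ^ k / fact k * z ^ Suc k"
      using t M L z by (intro mult_mono divide_left_mono power_mono fact_mono) auto
    also have "\<dots> = B k"
      by (simp add: B_def power_mult_distrib divide_inverse)
    finally show ?thesis .
  qed
  moreover have "summable B"
    unfolding B_def by (intro summable_mult summable_exp)
  ultimately have "uniform_limit {-z..z} (\<lambda>n t. \<Sum>k<n. D k t) (\<lambda>t. \<Sum>k. D k t) sequentially"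
    by (rule Weierstrass_m_test)
  then have "uniform_limit {-z..z} (\<lambda>n t. y0 + (\<Sum>k<n. D k t)) (\<lambda>t. y0 + (\<Sum>k. D k t)) sequentially"
    by (intro uniform_limit_intros)
  moreover have "y0 + (\<Sum>k<n. D k t) = iter n t" for n t
    unfolding D_def using sum_lessThan_telescope[of "\<lambda>k. iter k t" n] by simp
  ultimately show ?thesis
    using that by simp
qed

section \<open>The limit solves the initial value problem\<close>

lemma admissible_uniform_limit:
  assumes lim: "uniform_limit {-z..z} iter \<phi> sequentially"
  shows "admissible \<phi>"
  unfolding admissible_def
proof (intro conjI ballI)
  show "continuous_on {-z..z} \<phi>"
    using admissible_iter
    by (intro uniform_limit_theorem[OF _ lim] always_eventually) (auto simp: admissible_def)
next
  fix x assume x: "x \<in> {-z..z}"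
  \<comment> \<open>The box is closed, so the bound on the iterates survives the pointwise
    limit.\<close>
  have "(\<lambda>k. \<bar>iter k x - y0\<bar>) \<longlonglongrightarrow> \<bar>\<phi> x - y0\<bar>"
    using tendsto_uniform_limitI[OF lim x] by (intro tendsto_intros)
  then show "\<bar>\<phi> x - y0\<bar> \<le> b"
    using admissible_iter x by (intro LIMSEQ_le_const2) (auto simp: admissible_def)
qed

text \<open>Both sides are limits of the same sequence, since \<open>picard (iter k)\<close> is the
  shifted sequence \<open>iter (Suc k)\<close>.\<close>

lemma picard_fixed_point:
  assumes lim: "uniform_limit {-z..z} iter \<phi> sequentially" and t: "t \<in> {-z..z}"
  shows "picard \<phi> t = \<phi> t"
proof -
  have "(\<lambda>k. picard (iter k) t) \<longlonglongrightarrow> picard \<phi> t"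
  proof (rule LIMSEQ_I)
    fix r :: real assume r: "0 < r"
    define K where "K = (L1 + L2) * z"
    have K: "0 \<le> K" using L z by (simp add: K_def)
    \<comment> \<open>\<open>K\<close> is a Lipschitz constant of \<open>picard\<close> in the
      supremum norm. Dividing by \<open>K + 1\<close> covers \<open>K = 0\<close> and makes the
      final inequality strict.\<close>
    define e where "e = r / (K + 1)"
    have e: "0 < e" using r K by (simp add: e_def)
    obtain N where N: "\<And>k x. k \<ge> N \<Longrightarrow> x \<in> {-z..z} \<Longrightarrow> \<bar>iter k x - \<phi> x\<bar> < e"
      using uniform_limitD[OF lim e]
      unfolding eventually_sequentially dist_real_def by blast
    have "norm (picard (iter k) t - picard \<phi> t) < r" if k: "k \<ge> N" for k
    proof -
      have "\<bar>picard (iter k) t - picard \<phi> t\<bar> \<le> (L1 + L2) * e * \<bar>t\<bar> ^ Suc 0 / Suc 0"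
        using N[OF k] e t
        by (intro picard_diff_le admissible_iter admissible_uniform_limit lim)
          (auto intro: less_imp_le)
      also have "\<dots> \<le> (L1 + L2) * e * z"
        using t e L by (auto intro: mult_left_mono)
      also have "\<dots> = K * e"
        by (simp add: K_def)
      also have "\<dots> < (K + 1) * e"
        using e by simp
      also have "\<dots> = r"
        using K by (simp add: e_def)
      finally show ?thesis by simp
    qed
    then show "\<exists>no. \<forall>k\<ge>no. norm (picard (iter k) t - picard \<phi> t) < r"
      by blast
  qed
  moreover have "(\<lambda>k. iter (Suc k) t) \<longlonglongrightarrow> \<phi> t"
    using tendsto_uniform_limitI[OF lim t] by (rule LIMSEQ_Suc)
  ultimately show ?thesis
    unfolding iter_Suc by (rule LIMSEQ_unique)
qed

text \<open>The fundamental theorem of calculus differentiates \<open>picard \<phi>\<close>, and the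
  fixed point equation transfers the derivative to \<open>\<phi>\<close>.\<close>

lemma ivp_solution_uniform_limit:
  assumes lim: "uniform_limit {-z..z} iter \<phi> sequentially"
  shows "ivp_solution f (box_R a b y0) q y0 {-z..z} \<phi>"
  unfolding ivp_solution_def
proof (intro conjI ballI)
  have adm: "admissible \<phi>"
    using lim by (rule admissible_uniform_limit)
  fix t assume t: "t \<in> {-z..z}"
  show "(t, \<phi> t, \<phi> (q * t)) \<in> box_R a b y0"
    using adm t by (rule admissible_mem_box)
  show "(\<phi> has_real_derivative f (t, \<phi> t, \<phi> (q * t))) (at t within {-z..z})"
    using picard_has_real_derivative[OF adm t] unfolding rhs_def
    \<comment> \<open>The rule asks for a positive radius of agreement; 1 is arbitrary, as the two
      functions agree on the whole interval.\<close>
    by (rule has_field_derivative_transform_within[OF _ zero_less_one t])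
      (rule picard_fixed_point[OF lim])
next
  show "\<phi> 0 = y0"
    using picard_fixed_point[OF lim, of 0] z by (simp add: picard_def)
qed

end

theorem theorem3:
  fixes q y0 a b M L1 L2 \<zeta> :: real
    and f :: "real \<times> real \<times> real \<Rightarrow> real"
    and R :: "(real \<times> real \<times> real) set"
    and I :: "real set"
  assumes "0 < q" and "q < 1" and "a > 0" and "b > 0"
    and "R = box_R a b y0"
    and "continuous_on R f"
    and "M > 0" and "\<And>p. p \<in> R \<Longrightarrow> \<bar>f p\<bar> \<le> M"
    and "L1 \<ge> 0" and "L2 \<ge> 0"
    and "\<And>t u1 v1 u2 v2. (t, u1, v1) \<in> R \<Longrightarrow> (t, u2, v2) \<in> R \<Longrightarrow>
           \<bar>f (t, u1, v1) - f (t, u2, v2)\<bar> \<le> L1 * \<bar>u1 - u2\<bar> + L2 * \<bar>v1 - v2\<bar>"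
    and "\<zeta> = min a (b / M)"
    and "I = {-\<zeta>..\<zeta>}"
  shows "succ_approx_well_defined f R q y0 I \<and>
         (\<exists>\<phi>. (\<forall>t\<in>I. (\<lambda>k. succ_approx f q y0 k t) \<longlonglongrightarrow> \<phi> t) \<and>
              ivp_solution f R q y0 I \<phi>)"
proof -
  have "\<zeta> \<le> b / M"
    using assms(12) by simp
  then have "M * \<zeta> \<le> b"
    using assms(7) by (simp add: pos_le_divide_eq mult.commute)
  then interpret proportional_delay_ivp q y0 a b M L1 L2 \<zeta> f
    using assms by unfold_locales auto
  \<comment> \<open>Uniform convergence is needed to identify \<open>\<phi>\<close> as a solution;
    the pointwise convergence claimed is a consequence.\<close>
  obtain \<phi> where lim: "uniform_limit I (succ_approx f q y0) \<phi> sequentially"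
    using uniform_limit_iter assms(13) by blast
  show ?thesis
    using succ_approx_well_defined ivp_solution_uniform_limit lim tendsto_uniform_limitI[OF lim]
    unfolding assms(5,13) by blast
qed

end
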